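(* Let $\Phi=(A;\{E_i\}_{i=0}^d;A^*;\{E^*_i\}_{i=0}^d)$ be a Leonard system in $\mathcal{A}$ with parameter array $(\{\theta_i\}_{i=0}^d;\{\theta^*_i\}_{i=0}^d;\{\varphi_i\}_{i=1}^d;\{\phi_i\}_{i=1}^d)$, and let $\xi_0\in E_0V$, $\xi_d\in E_dV$, $\xi^*_0\in E^*_0V$, $\xi^*_d\in E^*_dV$ be nonzero vectors. Then (i) and (ii) hold. (i) Let $\{X_i\}_{i=0}^d$ denote one of the sequences $\{E_i\}_{i=0}^d$, $\{E_{d-i}\}_{i=0}^d$, $\{\tau_i(A)\}_{i=0}^d$, $\{\tau_{d-i}(A)\}_{i=0}^d$, $\{\eta_i(A)\}_{i=0}^d$, $\{\eta_{d-i}(A)\}_{i=0}^d$. Then for $0\le i\le d$, \begin{align*} \frac{\langle\xi^*_0,\xi^*_0\rangle}{\langle\xi_d,\xi^*_0\rangle}\sum_{r=0}^d\frac{X_rE^*_0E_dE^*_r}{\mathrm{tr}(E^*_rE_d)}\cdot E^*_i\xi_d &= X_i\xi^*_0,\\ \frac{\langle\xi^*_d,\xi^*_d\rangle}{\langle\xi_d,\xi^*_d\rangle}\sum_{r=0}^d\frac{X_rE^*_dE_dE^*_r}{\mathrm{tr}(E^*_rE_d)}\cdot E^*_i\xi_d &= X_i\xi^*_d,\\ \frac{\langle\xi^*_0,\xi^*_0\rangle}{\langle\xi_d,\xi^*_0\rangle}\sum_{r=0}^d\frac{X_{d-r}E^*_0E_dE^*_r}{\mathrm{tr}(E^*_rE_d)}\cdot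 E^*_{d-i}\xi_d &= X_i\xi^*_0,\\ \frac{\langle\xi^*_d,\xi^*_d\rangle}{\langle\xi_d,\xi^*_d\rangle}\sum_{r=0}^d\frac{X_{d-r}E^*_dE_dE^*_r}{\mathrm{tr}(E^*_rE_d)}\cdot E^*_{d-i}\xi_d &= X_i\xi^*_d. \end{align*} (ii) Let $\{X_i\}_{i=0}^d$ denote one of the sequences $\{E^*_i\}_{i=0}^d$, $\{E^*_{d-i}\}_{i=0}^d$, $\{\tau^*_i(A^* )\}_{i=0}^d$, $\{\tau^*_{d-i}(A^* )\}_{i=0}^d$, $\{\eta^*_i(A^* )\}_{i=0}^d$, $\{\eta^*_{d-i}(A^* )\}_{i=0}^d$. Then for $0\le i\le d$, \begin{align*} \frac{\eta_d(\theta_0)}{\varphi}\frac{\langle\xi_0,\xi^*_d\rangle}{\langle\xi_d,\xi^*_d\rangle}\sum_{r=0}^d\tau^*_r(\theta^*_r)\eta^*_{d-r}(\theta^*_r)X_rE_0E^*_r\cdot E^*_i\xi_d &= X_i\xi_0,\\ \sum_{r=0}^d\frac{X_rE_dE^*_r}{\mathrm{tr}(E^*_rE_d)}\cdot E^*_i\xi_d &= X_i\xi_d,\\ \frac{\eta_d(\theta_0)}{\varphi}\frac{\langle\xi_0,\xi^*_d\rangle}{\langle\xi_d,\xi^*_d\rangle}\sum_{r=0}^d\tau^*_r(\theta^*_r)\eta^*_{d-r}(\theta^*_r)X_{d-r}E_0E^*_r\cdot E^*_{d-i}\xi_d &= X_i\xi_0,\\ \sum_{r=0}^d\frac{X_{d-r}E_dE^*_r}{\mathrm{tr}(E^*_rE_d)}\cdot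 E^*_{d-i}\xi_d &= X_i\xi_d. \end{align*}
   Context: Let $\mathbb{K}$ be a field, $d\ge 0$ an integer, $\mathcal{A}$ a $\mathbb{K}$-algebra isomorphic to the algebra $\mathrm{Mat}_{d+1}(\mathbb{K})$ of all $(d+1)\times(d+1)$ matrices over $\mathbb{K}$, $I$ its identity, and $V$ an irreducible left $\mathcal{A}$-module (so $\dim V=d+1$). For $X\in\mathcal{A}$, $\mathrm{tr}(X)$ is the trace of $X$ (equivalently of its action on $V$). Leonard system. An element of $\mathcal{A}$ is multiplicity-free if it has $d+1$ mutually distinct eigenvalues in $\mathbb{K}$. If $A$ is multiplicity-free with eigenvalues $\theta_0,\dots,\theta_d$, the primitive idempotent of $A$ associated with $\theta_i$ is $E_i=\prod_{0\le j\le d,\,j\ne i}\frac{A-\theta_jI}{\theta_i-\theta_j}$ (the projection onto the one-dimensional $\theta_i$-eigenspace $E_iV$). A Leonard system in $\mathcal{A}$ is a sequence $\Phi=(A;\{E_i\}_{i=0}^d;A^*;\{E^*_i\}_{i=0}^d)$ such that: (i) each of $A,A^*$ is a multiplicity-free element of $\mathcal{A}$ ($A^*$ is just another element; no adjoint is meant); (ii) $\{E_i\}_{i=0}^d$ is an ordering of the primitive idempotents of $A$; (iii) $\{E^*_i\}_{i=0}^d$ is an ordering of the primitive idempotents of $A^*$; (iv) for $0\le i,j\le d$, $E_iA^*E_j=0$ if $|i-j|>1$ and $E_iA^*E_j\ne0$ if $|i-j|=1$; (v) for $0\le i,j\le d$, $E^*_iAE^*_j=0$ if $|i-j|>1$ and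 $E^*_iAE^*_j\neq0$ if $|i-j|=1$. Parameter array. $\theta_i$ (resp. $\theta^*_i$) is the eigenvalue of $A$ (resp. $A^*$) associated with $E_i$ (resp. $E^*_i$). For $0\le i\le d$ define polynomials $\tau_i=(\lambda-\theta_0)(\lambda-\theta_1)\cdots(\lambda-\theta_{i-1})$, $\eta_i=(\lambda-\theta_d)(\lambda-\theta_{d-1})\cdots(\lambda-\theta_{d-i+1})$, $\tau^*_i=(\lambda-\theta^*_0)(\lambda-\theta^*_1)\cdots(\lambda-\theta^*_{i-1})$, $\eta^*_i=(\lambda-\theta^*_d)(\lambda-\theta^*_{d-1})\cdots(\lambda-\theta^*_{d-i+1})$. For $1\le i\le d$ define $\varphi_i=(\theta^*_0-\theta^*_i)\frac{\mathrm{tr}(\tau_i(A)E^*_0)}{\mathrm{tr}(\tau_{i-1}(A)E^*_0)}$ and $\phi_i=(\theta^*_0-\theta^*_i)\frac{\mathrm{tr}(\eta_i(A)E^*_0)}{\mathrm{tr}(\eta_{i-1}(A)E^*_0)}$; the denominators, and all $\varphi_i,\phi_i$, are known to be nonzero. The parameter array of $\Phi$ is $(\{\theta_i\}_{i=0}^d;\{\theta^*_i\}_{i=0}^d;\{\varphi_i\}_{i=1}^d;\{\phi_i\}_{i=1}^d)$. Abbreviate $\varphi=\varphi_1\varphi_2\cdots\varphi_d$ and $\phi=\phi_1\phi_2\cdots\phi_d$. Empty products are $1$. Bilinear form. There is a unique antiautomorphism $\dagger$ of $\mathcal{A}$ ($\mathbb{K}$-linear bijection with $(XY)^\dagger=Y^\dagger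 X^\dagger$) with $A^\dagger=A$ and $A^{*\dagger}=A^*$. $\langle\,,\rangle$ denotes a fixed nonzero bilinear form on $V$ with $\langle Xu,v\rangle=\langle u,X^\dagger v\rangle$ for all $X\in\mathcal{A}$, $u,v\in V$; it exists, is unique up to a nonzero scalar factor, and is nondegenerate and symmetric. All scalars appearing in denominators (traces and inner products) are known to be nonzero. The notation $T\cdot v$ means the element $T\in\mathcal{A}$ (including the scalar prefactor and the whole sum) applied to $v\in V$. *)

theory Defs
  imports "HOL-Analysis.Analysis" "HOL-Computational_Algebra.Polynomial"
begin

locale assoc_algebra = vector_space sA
  for sA :: "'k::field \<Rightarrow> 'a::ring_1 \<Rightarrow> 'a" +
  assumes scale_mult_left: "sA c x * y = sA c (x * y)"
    and scale_mult_right: "x * sA c y = sA c (x * y)"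

locale algebra_module = alg: assoc_algebra sA + V: vector_space sV
  for sA :: "'k::field \<Rightarrow> 'a::ring_1 \<Rightarrow> 'a"
    and sV :: "'k \<Rightarrow> 'v::ab_group_add \<Rightarrow> 'v" +
  fixes act :: "'a \<Rightarrow> 'v \<Rightarrow> 'v"
  assumes act_linear: "Vector_Spaces.linear sV sV (act x)"
    and act_add: "act (x + y) v = act x v + act y v"
    and act_scale: "act (sA c x) v = sV c (act x v)"
    and act_mult: "act (x * y) v = act x (act y v)"
    and act_one: "act 1 v = v"

locale irreducible_module = algebra_module sA sV act
  for sA :: "'k::field \<Rightarrow> 'a::ring_1 \<Rightarrow> 'a"
    and sV :: "'k \<Rightarrow> 'v::ab_group_add \<Rightarrow> 'v"
    and act :: "'a \<Rightarrow> 'v \<Rightarrow> 'v" +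
  assumes nontrivial: "\<exists>v::'v. v \<noteq> 0"
    and no_proper_submodule:
      "V.subspace W \<Longrightarrow> (\<And>x w. w \<in> W \<Longrightarrow> act x w \<in> W) \<Longrightarrow> W = {0} \<or> W = UNIV"

text \<open>An algebra isomorphism onto the full matrix algebra; rows and columns are indexed by
  the finite type \<open>'n\<close>, so the size of the matrices is \<open>CARD('n)\<close>.\<close>

definition matrix_algebra_iso ::
    "('k::field \<Rightarrow> 'a::ring_1 \<Rightarrow> 'a) \<Rightarrow> ('a \<Rightarrow> 'k^'n^'n) \<Rightarrow> bool" where
  "matrix_algebra_iso sA \<rho> \<longleftrightarrow>
     bij \<rho> \<and> \<rho> 1 = mat 1 \<and>
     (\<forall>x y. \<rho> (x + y) = \<rho> x + \<rho> y) \<and>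
     (\<forall>x y. \<rho> (x * y) = \<rho> x ** \<rho> y) \<and>
     (\<forall>c x. \<rho> (sA c x) = (\<chi> i j. c * \<rho> x $ i $ j))"

definition antiautomorphism ::
    "('k::field \<Rightarrow> 'a::ring_1 \<Rightarrow> 'a) \<Rightarrow> ('a \<Rightarrow> 'a) \<Rightarrow> bool" where
  "antiautomorphism sA D \<longleftrightarrow>
     Vector_Spaces.linear sA sA D \<and> bij D \<and> (\<forall>x y. D (x * y) = D y * D x)"

definition bilinear_form ::
    "('k::field \<Rightarrow> 'v::ab_group_add \<Rightarrow> 'v) \<Rightarrow> ('v \<Rightarrow> 'v \<Rightarrow> 'k) \<Rightarrow> bool" where
  "bilinear_form sV B \<longleftrightarrow>
     (\<forall>u. Vector_Spaces.linear sV (*) (\<lambda>v. B u v)) \<and>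
     (\<forall>v. Vector_Spaces.linear sV (*) (\<lambda>u. B u v))"

text \<open>\<open>alg_poly sA p X\<close> is the element \<open>p(X)\<close>; the library's \<open>poly\<close> only evaluates
  in the coefficient ring.\<close>

definition alg_poly ::
    "('k::field \<Rightarrow> 'a::ring_1 \<Rightarrow> 'a) \<Rightarrow> 'k poly \<Rightarrow> 'a \<Rightarrow> 'a" where
  "alg_poly sA p X = (\<Sum>k\<le>degree p. sA (coeff p k) (X ^ k))"

definition eigenvalues ::
    "('k::field \<Rightarrow> 'v::ab_group_add \<Rightarrow> 'v) \<Rightarrow> ('a \<Rightarrow> 'v \<Rightarrow> 'v) \<Rightarrow> 'a \<Rightarrow> 'k set" where
  "eigenvalues sV act X = {t. \<exists>v. v \<noteq> 0 \<and> act X v = sV t v}"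

definition multiplicity_free ::
    "nat \<Rightarrow> ('k::field \<Rightarrow> 'v::ab_group_add \<Rightarrow> 'v) \<Rightarrow> ('a \<Rightarrow> 'v \<Rightarrow> 'v) \<Rightarrow> 'a \<Rightarrow> bool" where
  "multiplicity_free d sV act X \<longleftrightarrow> card (eigenvalues sV act X) = Suc d"

definition primitive_idempotent ::
    "nat \<Rightarrow> ('k::field \<Rightarrow> 'a::ring_1 \<Rightarrow> 'a) \<Rightarrow> 'a \<Rightarrow> (nat \<Rightarrow> 'k) \<Rightarrow> nat \<Rightarrow> 'a" where
  "primitive_idempotent d sA X \<theta> i =
     prod_list (map (\<lambda>j. sA (1 / (\<theta> i - \<theta> j)) (X - sA (\<theta> j) 1))
                    (filter (\<lambda>j. j \<noteq> i) [0..<Suc d]))"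

text \<open>\<open>E\<^sub>0, \<dots>, E\<^sub>d\<close> is an ordering of the primitive idempotents of \<open>X\<close>, and
  \<open>\<theta>\<^sub>i\<close> is the eigenvalue of \<open>X\<close> associated with \<open>E\<^sub>i\<close>. Here and
  below, values of sequences at indices above \<open>d\<close> are irrelevant.\<close>

definition idempotent_ordering ::
    "nat \<Rightarrow> ('k::field \<Rightarrow> 'a::ring_1 \<Rightarrow> 'a) \<Rightarrow> ('k \<Rightarrow> 'v::ab_group_add \<Rightarrow> 'v) \<Rightarrow>
     ('a \<Rightarrow> 'v \<Rightarrow> 'v) \<Rightarrow> 'a \<Rightarrow> (nat \<Rightarrow> 'a) \<Rightarrow> (nat \<Rightarrow> 'k) \<Rightarrow> bool" where
  "idempotent_ordering d sA sV act X E \<theta> \<longleftrightarrow>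
     bij_betw \<theta> {..d} (eigenvalues sV act X) \<and>
     (\<forall>i\<le>d. E i = primitive_idempotent d sA X \<theta> i)"

definition leonard_system ::
    "nat \<Rightarrow> ('k::field \<Rightarrow> 'a::ring_1 \<Rightarrow> 'a) \<Rightarrow> ('k \<Rightarrow> 'v::ab_group_add \<Rightarrow> 'v) \<Rightarrow>
     ('a \<Rightarrow> 'v \<Rightarrow> 'v) \<Rightarrow> 'a \<Rightarrow> (nat \<Rightarrow> 'a) \<Rightarrow> 'a \<Rightarrow> (nat \<Rightarrow> 'a) \<Rightarrow> bool" where
  "leonard_system d sA sV act A E As Es \<longleftrightarrow>
     multiplicity_free d sV act A \<and> multiplicity_free d sV act As \<and>
     (\<exists>\<theta>. idempotent_ordering d sA sV act A E \<theta>) \<and>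
     (\<exists>\<theta>s. idempotent_ordering d sA sV act As Es \<theta>s) \<and>
     (\<forall>i\<le>d. \<forall>j\<le>d. (\<bar>int i - int j\<bar> > 1 \<longrightarrow> E i * As * E j = 0) \<and>
                   (\<bar>int i - int j\<bar> = 1 \<longrightarrow> E i * As * E j \<noteq> 0)) \<and>
     (\<forall>i\<le>d. \<forall>j\<le>d. (\<bar>int i - int j\<bar> > 1 \<longrightarrow> Es i * A * Es j = 0) \<and>
                   (\<bar>int i - int j\<bar> = 1 \<longrightarrow> Es i * A * Es j \<noteq> 0))"

definition tau_poly :: "(nat \<Rightarrow> 'k::field) \<Rightarrow> nat \<Rightarrow> 'k poly" where
  "tau_poly \<theta> i = (\<Prod>h<i. [:- \<theta> h, 1:])"

definition eta_poly :: "nat \<Rightarrow> (nat \<Rightarrow> 'k::field) \<Rightarrow> nat \<Rightarrow> 'k poly" where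
  "eta_poly d \<theta> i = (\<Prod>h<i. [:- \<theta> (d - h), 1:])"

text \<open>The trace of an algebra element is that of its matrix under an isomorphism \<open>\<rho>\<close>;
  it does not depend on \<open>\<rho>\<close>.\<close>

definition alg_trace :: "('a \<Rightarrow> 'k::field^'n^'n) \<Rightarrow> 'a \<Rightarrow> 'k" where
  "alg_trace \<rho> X = trace (\<rho> X)"

text \<open>\<open>\<phi>1\<close> is the first split sequence (\<open>varphi\<close>), \<open>\<phi>2\<close> the second (\<open>phi\<close>).\<close>

definition parameter_array ::
    "nat \<Rightarrow> ('k::field \<Rightarrow> 'a::ring_1 \<Rightarrow> 'a) \<Rightarrow> ('k \<Rightarrow> 'v::ab_group_add \<Rightarrow> 'v) \<Rightarrow>
     ('a \<Rightarrow> 'v \<Rightarrow> 'v) \<Rightarrow> ('a \<Rightarrow> 'k^'n^'n) \<Rightarrow>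
     'a \<Rightarrow> (nat \<Rightarrow> 'a) \<Rightarrow> 'a \<Rightarrow> (nat \<Rightarrow> 'a) \<Rightarrow>
     (nat \<Rightarrow> 'k) \<Rightarrow> (nat \<Rightarrow> 'k) \<Rightarrow> (nat \<Rightarrow> 'k) \<Rightarrow> (nat \<Rightarrow> 'k) \<Rightarrow> bool" where
  "parameter_array d sA sV act \<rho> A E As Es \<theta> \<theta>s \<phi>1 \<phi>2 \<longleftrightarrow>
     idempotent_ordering d sA sV act A E \<theta> \<and>
     idempotent_ordering d sA sV act As Es \<theta>s \<and>
     (\<forall>i\<in>{1..d}. \<phi>1 i = (\<theta>s 0 - \<theta>s i) *
        (alg_trace \<rho> (alg_poly sA (tau_poly \<theta> i) A * Es 0) /
         alg_trace \<rho> (alg_poly sA (tau_poly \<theta> (i - 1)) A * Es 0))) \<and>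
     (\<forall>i\<in>{1..d}. \<phi>2 i = (\<theta>s 0 - \<theta>s i) *
        (alg_trace \<rho> (alg_poly sA (eta_poly d \<theta> i) A * Es 0) /
         alg_trace \<rho> (alg_poly sA (eta_poly d \<theta> (i - 1)) A * Es 0)))"

definition attached_sequences ::
    "nat \<Rightarrow> ('k::field \<Rightarrow> 'a::ring_1 \<Rightarrow> 'a) \<Rightarrow> 'a \<Rightarrow> (nat \<Rightarrow> 'a) \<Rightarrow> (nat \<Rightarrow> 'k) \<Rightarrow>
     (nat \<Rightarrow> 'a) set" where
  "attached_sequences d sA A E \<theta> =
     {\<lambda>i. E i, \<lambda>i. E (d - i),
      \<lambda>i. alg_poly sA (tau_poly \<theta> i) A, \<lambda>i. alg_poly sA (tau_poly \<theta> (d - i)) A,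
      \<lambda>i. alg_poly sA (eta_poly d \<theta> i) A, \<lambda>i. alg_poly sA (eta_poly d \<theta> (d - i)) A}"

end

theory Submission
  imports Defs
begin

text \<open>Write \<open>E\<^sub>i\<close> and \<open>E*\<^sub>i\<close> for the two families of idempotents, \<open>A\<close> and \<open>A*\<close> for the two operators.
As \<open>E*\<^sub>r E*\<^sub>i = 0\<close> for \<open>r \<noteq> i\<close>, each sum applied to \<open>E*\<^sub>i \<xi>\<^sub>d\<close> keeps one term only
(\<open>sum_collapse\<close>), so the formulas compute the vectors \<open>E\<^sub>d E*\<^sub>i \<xi>\<^sub>d\<close>, \<open>E*\<^sub>k E\<^sub>d E*\<^sub>i \<xi>\<^sub>d\<close>
and \<open>E\<^sub>0 E*\<^sub>i \<xi>\<^sub>d\<close>. The lemmas are stated for any sequence \<open>Y\<close> in the algebra; the formulas with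
\<open>X\<^sub>d\<^sub>-\<^sub>r\<close> and \<open>E*\<^sub>d\<^sub>-\<^sub>i\<close> are then the case \<open>Y r = X (d - r)\<close> at the index \<open>d - i\<close>.

The first vector comes from the rank-one law \<open>e X e = tr(X e) e\<close>: it is \<open>tr(E*\<^sub>i E\<^sub>d) \<xi>\<^sub>d\<close>, and the
trace is nonzero because \<open>\<xi>\<^sub>d\<close>, lying at an end of the chain on which \<open>A*\<close> acts, generates \<open>V\<close>
under \<open>A*\<close> (\<open>cross_nonzero\<close>). For the second vector, the antiautomorphism fixes all the idempotents,
so they are orthogonal projections for the form: \<open>E*\<^sub>k u = \<langle>u,\<xi>\<rangle>/\<langle>\<xi>,\<xi>\<rangle> \<xi>\<close> for a nonzero \<open>\<xi>\<close> in
\<open>E*\<^sub>k V\<close> (\<open>projection_formula\<close>).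

For the third vector, tridiagonality makes \<open>E\<^sub>0 p(A*) E\<^sub>d\<close> the same for all monic \<open>p\<close> of degree \<open>d\<close>
(\<open>poly_top\<close>). The polynomial \<open>\<tau>*\<^sub>i \<eta>*\<^sub>d\<^sub>-\<^sub>i\<close> is monic of degree \<open>d\<close> and vanishes at every
eigenvalue of \<open>A*\<close> but \<open>\<theta>*\<^sub>i\<close>, hence \<open>\<tau>*\<^sub>i(\<theta>*\<^sub>i) \<eta>*\<^sub>d\<^sub>-\<^sub>i(\<theta>*\<^sub>i) E\<^sub>0 E*\<^sub>i E\<^sub>d\<close> is independent
of \<open>i\<close> (\<open>end_sandwich\<close>), and at \<open>i = d\<close> the projection formula evaluates it up to the constant
\<open>tr(E*\<^sub>d E\<^sub>0)\<close>.

That constant is read off from the first split sequence, whose product is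
\<open>\<eta>\<^sub>d(\<theta>\<^sub>0) \<tau>*\<^sub>d(\<theta>*\<^sub>d) tr(E*\<^sub>d E\<^sub>0)\<close> (\<open>split_sequence_product\<close>). The definition telescopes to the same
kind of expression with \<open>tr(E\<^sub>d E*\<^sub>0)\<close> instead, since no denominator vanishes (\<open>tr_tau_nonzero\<close>); evaluating
\<open>E*\<^sub>0 \<tau>\<^sub>d(A) \<tau>*\<^sub>d(A*) E\<^sub>0\<close> in two ways exchanges the two corners (\<open>corner_trace_exchange\<close>).\<close>

section \<open>Rank-one idempotents and the trace\<close>

text \<open>With these laws of the trace, the arguments about idempotents can be carried out in the algebra itself, without
matrices. Nondegeneracy is what detects that an element is zero.\<close>

locale trace_algebra = assoc_algebra sA
  for sA :: "'k::field \<Rightarrow> 'a::ring_1 \<Rightarrow> 'a" +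
  fixes tr :: "'a \<Rightarrow> 'k"
  assumes tr_scale: "tr (sA c x) = c * tr x"
    and tr_nondegenerate: "(\<And>z. tr (z * x) = 0) \<Longrightarrow> x = 0"

text \<open>The spectral resolution of an operator with \<open>d + 1\<close> distinct eigenvalues. The corner law says that the
idempotents have rank one.\<close>

locale eigen_resolution = trace_algebra sA tr
  for sA :: "'k::field \<Rightarrow> 'a::ring_1 \<Rightarrow> 'a" and tr :: "'a \<Rightarrow> 'k" +
  fixes d :: nat and A :: 'a and E :: "nat \<Rightarrow> 'a" and \<theta> :: "nat \<Rightarrow> 'k"
  assumes theta_inj: "inj_on \<theta> {..d}"
    and idem_orth: "i \<le> d \<Longrightarrow> j \<le> d \<Longrightarrow> E i * E j = (if i = j then E i else 0)"
    and idem_sum: "(\<Sum>i\<le>d. E i) = 1"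
    and idem_nonzero: "i \<le> d \<Longrightarrow> E i \<noteq> 0"
    and idem_eigen: "i \<le> d \<Longrightarrow> A * E i = sA (\<theta> i) (E i)"
    and idem_corner: "i \<le> d \<Longrightarrow> E i * X * E i = sA (tr (X * E i)) (E i)"
begin

text \<open>Inserting the identity as the sum of the idempotents turns a product into a sum over paths; with a tridiagonal
factor almost all of its terms vanish.\<close>

lemma insert_idem_sum: "X * Y = (\<Sum>m\<le>d. X * E m * Y)"
proof -
  have "X * Y = X * (\<Sum>m\<le>d. E m) * Y"
    by (simp add: idem_sum)
  then show ?thesis
    by (simp add: sum_distrib_left sum_distrib_right)
qed

lemma idem_eigen_left:
  assumes "i \<le> d"
  shows "E i * A = sA (\<theta> i) (E i)"
proof -
  have "E i * A = (\<Sum>m\<le>d. E i * (A * E m))"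
    using insert_idem_sum[of "E i * A" 1] by (simp add: mult.assoc)
  also have "\<dots> = (\<Sum>m\<le>d. if m = i then sA (\<theta> i) (E i) else 0)"
    by (rule sum.cong) (auto simp: assms idem_eigen idem_orth scale_mult_right)
  finally show ?thesis
    using assms by simp
qed

text \<open>A product through a rank-one idempotent vanishes only if one of its two halves does. If \<open>X e Y = 0\<close>
but \<open>e Y \<noteq> 0\<close>, the corner law forces \<open>tr(Z X e) = 0\<close> for all \<open>Z\<close>.\<close>

lemma sandwich_nonzero:
  assumes i: "i \<le> d" and X: "X * E i \<noteq> 0" and Y: "E i * Y \<noteq> 0"
  shows "X * E i * Y \<noteq> 0"
proof
  assume zero: "X * E i * Y = 0"
  have "tr (Z * (X * E i)) = 0" for Z
  proof -
    have "sA (tr (Z * X * E i)) (E i * Y) = E i * (Z * X) * E i * Y"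
      by (simp add: idem_corner[OF i] scale_mult_left)
    also have "\<dots> = E i * Z * (X * E i * Y)"
      by (simp add: mult.assoc)
    finally show ?thesis
      using zero Y by (simp add: mult.assoc)
  qed
  then show False
    using X tr_nondegenerate by blast
qed

lemma tr_idem: "i \<le> d \<Longrightarrow> tr (E i) = 1"
  using idem_corner[of i 1] idem_orth[of i i] idem_nonzero[of i]
  by (simp) (metis scale_one scale_right_imp_eq)

lemma alg_poly_idem:
  assumes "i \<le> d"
  shows "alg_poly sA p A * E i = sA (poly p (\<theta> i)) (E i)"
proof -
  have power: "A ^ k * E i = sA (\<theta> i ^ k) (E i)" for k
  proof (induction k)
    case (Suc k)
    have "A ^ Suc k * E i = A * (A ^ k * E i)"
      by (simp add: mult.assoc)
    also have "\<dots> = sA (\<theta> i ^ Suc k) (E i)"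
      using assms by (simp add: Suc scale_mult_right idem_eigen mult.commute)
    finally show ?case .
  qed simp
  have "alg_poly sA p A * E i = (\<Sum>k\<le>degree p. sA (coeff p k * \<theta> i ^ k) (E i))"
    by (simp add: alg_poly_def sum_distrib_right scale_mult_left power)
  also have "\<dots> = sA (poly p (\<theta> i)) (E i)"
    by (simp add: poly_altdef scale_sum_left)
  finally show ?thesis .
qed

lemma alg_poly_resolve: "alg_poly sA p A = (\<Sum>i\<le>d. sA (poly p (\<theta> i)) (E i))"
  using insert_idem_sum[of "alg_poly sA p A" 1] by (simp add: alg_poly_idem)

lemma idem_alg_poly:
  assumes "i \<le> d"
  shows "E i * alg_poly sA p A = sA (poly p (\<theta> i)) (E i)"
proof -
  have "E i * alg_poly sA p A = (\<Sum>j\<le>d. if j = i then sA (poly p (\<theta> i)) (E i) else 0)"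
    unfolding alg_poly_resolve sum_distrib_left
    by (rule sum.cong) (auto simp: assms idem_orth scale_mult_right)
  then show ?thesis
    using assms by simp
qed

lemma alg_poly_single:
  assumes "i \<le> d" and "\<And>j. j \<le> d \<Longrightarrow> j \<noteq> i \<Longrightarrow> poly p (\<theta> j) = 0"
  shows "alg_poly sA p A = sA (poly p (\<theta> i)) (E i)"
proof -
  have "alg_poly sA p A = (\<Sum>j\<le>d. if j = i then sA (poly p (\<theta> i)) (E i) else 0)"
    unfolding alg_poly_resolve by (rule sum.cong) (auto simp: assms)
  then show ?thesis
    using assms(1) by simp
qed

text \<open>Comparing eigenvalues on the two sides of \<open>D(A E\<^sub>k) E\<^sub>m = D(E\<^sub>k) A E\<^sub>m\<close> shows
\<open>D(E\<^sub>k) E\<^sub>m = 0\<close> for \<open>k \<noteq> m\<close>. Then \<open>D(E\<^sub>i) E\<^sub>i\<close> equals both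
\<open>\<Sum>\<^sub>k D(E\<^sub>k) E\<^sub>i = E\<^sub>i\<close> and \<open>\<Sum>\<^sub>k D(E\<^sub>i) E\<^sub>k = D(E\<^sub>i)\<close>.\<close>

lemma antiautomorphism_fixes_idem:
  assumes D: "antiautomorphism sA D" and DA: "D A = A" and i: "i \<le> d"
  shows "D (E i) = E i"
proof -
  have lin: "Vector_Spaces.linear sA sA D" and surj: "surj D"
    and mult: "\<And>x y. D (x * y) = D y * D x"
    using D by (auto simp: antiautomorphism_def bij_def)
  interpret D: Vector_Spaces.linear sA sA D
    by (rule lin)
  have one: "D 1 = 1"
    by (metis mult mult_1 mult_1_right surj surj_def)
  have off: "D (E k) * E m = 0" if k: "k \<le> d" "m \<le> d" "k \<noteq> m" for k m
  proof -
    have "sA (\<theta> k) (D (E k) * E m) = D (A * E k) * E m"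
      using k by (simp add: idem_eigen D.scale scale_mult_left)
    also have "\<dots> = D (E k) * (A * E m)"
      by (simp add: mult DA mult.assoc)
    also have "\<dots> = sA (\<theta> m) (D (E k) * E m)"
      using k by (simp add: idem_eigen scale_mult_right)
    finally have "\<theta> k = \<theta> m \<or> D (E k) * E m = 0"
      by simp
    then show ?thesis
      using k theta_inj by (auto dest: inj_onD)
  qed
  have sumD: "(\<Sum>k\<le>d. D (E k)) = 1"
    using one by (simp flip: idem_sum D.sum)
  have "E i = (\<Sum>k\<le>d. D (E k) * E i)"
    by (simp add: sumD flip: sum_distrib_right)
  also have "\<dots> = (\<Sum>k\<le>d. if k = i then D (E i) * E i else 0)"
    by (rule sum.cong) (auto simp: off i)
  also have "\<dots> = (\<Sum>k\<le>d. D (E i) * E k)"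
    by (rule sum.cong) (auto simp: off i)
  also have "\<dots> = D (E i)"
    by (simp add: idem_sum flip: sum_distrib_left)
  finally show ?thesis by simp
qed

text \<open>Reversal carries statements about the end \<open>E 0\<close> over to the end \<open>E d\<close>.\<close>

lemma reversed: "eigen_resolution sA tr d A (\<lambda>i. E (d - i)) (\<lambda>i. \<theta> (d - i))"
proof
  show "inj_on (\<lambda>i. \<theta> (d - i)) {..d}"
  proof (rule inj_onI)
    fix i j
    assume "i \<in> {..d}" "j \<in> {..d}" "\<theta> (d - i) = \<theta> (d - j)"
    then show "i = j"
      using inj_onD[OF theta_inj, of "d - i" "d - j"] by auto
  qed
  show "(\<Sum>i\<le>d. E (d - i)) = 1"
    using idem_sum sum.nat_diff_reindex[of E "Suc d"] by (simp add: lessThan_Suc_atMost)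
qed (auto simp: idem_orth idem_nonzero idem_eigen idem_corner)

end


section \<open>Irreducible tridiagonal action\<close>

text \<open>One half of the Leonard conditions, so that every fact below can be used for both operators: a Leonard system is
a tridiagonal pair in both orders.\<close>

locale tridiagonal_pair =
  R: eigen_resolution sA tr d A E \<theta> + S: eigen_resolution sA tr d As Es \<theta>s
  for sA :: "'k::field \<Rightarrow> 'a::ring_1 \<Rightarrow> 'a" and tr d A E \<theta> As Es \<theta>s +
  assumes tridiagonal: "i \<le> d \<Longrightarrow> j \<le> d \<Longrightarrow> \<bar>int i - int j\<bar> > 1 \<Longrightarrow> E i * As * E j = 0"
    and adjacent: "i \<le> d \<Longrightarrow> j \<le> d \<Longrightarrow> \<bar>int i - int j\<bar> = 1 \<Longrightarrow> E i * As * E j \<noteq> 0"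
begin

text \<open>Each factor \<open>As\<close> moves the index by at most one step.\<close>

lemma power_far:
  assumes "i \<le> d" "j \<le> d" "int k < \<bar>int i - int j\<bar>"
  shows "E i * As ^ k * E j = 0"
  using assms
proof (induction k arbitrary: i)
  case 0
  then show ?case
    by (auto simp: R.idem_orth)
next
  case (Suc k)
  have "E i * As * E m * (As ^ k * E j) = 0" if m: "m \<le> d" for m
  proof (cases "\<bar>int i - int m\<bar> > 1")
    case True
    then show ?thesis
      using tridiagonal[of i m] Suc.prems m by simp
  next
    case False
    then have "E m * As ^ k * E j = 0"
      using Suc.prems m by (intro Suc.IH) auto
    then show ?thesis
      by (simp add: mult.assoc)
  qed
  then show ?case
    using R.insert_idem_sum[of "E i * As" "As ^ k * E j"] by (simp add: mult.assoc)
qed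

lemma poly_expand:
  "E i * alg_poly sA p As * E j = (\<Sum>l\<le>degree p. sA (coeff p l) (E i * As ^ l * E j))"
  by (simp add: alg_poly_def sum_distrib_left sum_distrib_right R.scale_mult_left R.scale_mult_right)

lemma poly_far:
  assumes "i \<le> d" "j \<le> d" "int (degree p) < \<bar>int i - int j\<bar>"
  shows "E i * alg_poly sA p As * E j = 0"
  unfolding poly_expand using assms by (intro sum.neutral) (auto simp: power_far)

text \<open>At distance equal to the degree only the leading term contributes, so all monic polynomials of that degree give
the same element. This is the source of every comparison between \<open>\<tau>\<close> and \<open>\<eta>\<close> below.\<close>

lemma poly_top:
  assumes "i \<le> d" "j \<le> d" and p: "lead_coeff p = 1" "int (degree p) = \<bar>int i - int j\<bar>"
  shows "E i * alg_poly sA p As * E j = E i * As ^ degree p * E j"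
proof -
  have "E i * alg_poly sA p As * E j =
      (\<Sum>l\<le>degree p. if l = degree p then E i * As ^ degree p * E j else 0)"
    unfolding poly_expand using assms by (intro sum.cong) (auto simp: power_far)
  then show ?thesis
    by simp
qed

text \<open>There is just one shortest path from \<open>0\<close> to \<open>i\<close>, and each of its steps is nonzero.\<close>

lemma power_corner_nonzero: "i \<le> d \<Longrightarrow> E i * As ^ i * E 0 \<noteq> 0"
proof (induction i)
  case 0
  then show ?case
    by (simp add: R.idem_orth R.idem_nonzero)
next
  case (Suc i)
  have other: "E (Suc i) * As * E m * (As ^ i * E 0) = 0" if m: "m \<le> d" "m \<noteq> i" for m
  proof (cases "m < i")
    case True
    then show ?thesis
      using tridiagonal[of "Suc i" m] Suc.prems m by simp
  next
    case False
    then have "E m * As ^ i * E 0 = 0"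
      using m by (intro power_far) auto
    then show ?thesis
      by (simp add: mult.assoc)
  qed
  have "E (Suc i) * As ^ Suc i * E 0 = (\<Sum>m\<le>d. E (Suc i) * As * E m * (As ^ i * E 0))"
    using R.insert_idem_sum[of "E (Suc i) * As" "As ^ i * E 0"] by (simp add: mult.assoc)
  also have "\<dots> = (\<Sum>m\<le>d. if m = i then E (Suc i) * As * E i * (As ^ i * E 0) else 0)"
    by (rule sum.cong) (auto simp: other)
  also have "\<dots> = E (Suc i) * As * E i * (As ^ i * E 0)"
    using Suc.prems by simp
  also have "\<dots> \<noteq> 0"
    using Suc adjacent[of "Suc i" i]
    by (intro R.sandwich_nonzero) (auto simp: mult.assoc)
  finally show ?case .
qed

text \<open>An end of the chain generates everything: if \<open>Es r\<close> annihilates \<open>E 0\<close>, then, as \<open>Es r\<close> is a left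
eigenvector of \<open>As\<close> and \<open>As\<close> leads from each \<open>E k\<close> to \<open>E (Suc k)\<close>, it annihilates every \<open>E j\<close>
and thus their sum \<open>1\<close>.\<close>

lemma cross_nonzero:
  assumes r: "r \<le> d"
  shows "Es r * E 0 \<noteq> 0"
proof
  assume zero: "Es r * E 0 = 0"
  have all: "j \<le> d \<Longrightarrow> Es r * E j = 0" for j
  proof (induction j rule: less_induct)
    case (less j)
    show ?case
    proof (cases j)
      case 0
      then show ?thesis
        using zero by simp
    next
      case (Suc k)
      have other: "Es r * E m * (As * E k) = 0" if m: "m \<le> d" "m \<noteq> j" for m
      proof (cases "m < j")
        case True
        then show ?thesis
          using less.IH m by simp
      next
        case False
        then have "E m * As * E k = 0"
          using m less.prems Suc by (intro tridiagonal) auto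
        then show ?thesis
          by (simp add: mult.assoc)
      qed
      have "Es r * (As * E k) = (\<Sum>m\<le>d. Es r * E m * (As * E k))"
        by (rule R.insert_idem_sum)
      also have "\<dots> = (\<Sum>m\<le>d. if m = j then Es r * E j * (As * E k) else 0)"
        by (rule sum.cong) (auto simp: other)
      also have "\<dots> = Es r * E j * (As * E k)"
        using less.prems by simp
      finally have "Es r * E j * (As * E k) = Es r * As * E k"
        by (simp add: mult.assoc)
      also have "\<dots> = sA (\<theta>s r) (Es r * E k)"
        using r by (simp add: S.idem_eigen_left R.scale_mult_left)
      also have "\<dots> = 0"
        using less.IH[of k] less.prems Suc by simp
      finally show ?thesis
        using R.sandwich_nonzero[of j "Es r" "As * E k"] adjacent[of j k] less.prems Suc
        by (auto simp: mult.assoc)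
    qed
  qed
  have "Es r = (\<Sum>j\<le>d. Es r * E j)"
    using R.insert_idem_sum[of "Es r" 1] by simp
  then show False
    using all S.idem_nonzero[OF r] by simp
qed

lemma reversed: "tridiagonal_pair sA tr d A (\<lambda>i. E (d - i)) (\<lambda>i. \<theta> (d - i)) As Es \<theta>s"
proof -
  interpret rev: eigen_resolution sA tr d A "\<lambda>i. E (d - i)" "\<lambda>i. \<theta> (d - i)"
    by (rule R.reversed)
  show ?thesis
  proof unfold_locales
    fix i j
    assume ij: "i \<le> d" "j \<le> d"
    then have dist: "\<bar>int (d - i) - int (d - j)\<bar> = \<bar>int i - int j\<bar>"
      by auto
    show "E (d - i) * As * E (d - j) = 0" if "\<bar>int i - int j\<bar> > 1"
      using that dist by (intro tridiagonal) auto
    show "E (d - i) * As * E (d - j) \<noteq> 0" if "\<bar>int i - int j\<bar> = 1"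
      using that dist by (intro adjacent) auto
  qed
qed

end

section \<open>Products of monic linear polynomials\<close>

lemma monic_linear_product:
  fixes f :: "nat \<Rightarrow> 'k::field"
  shows "degree (\<Prod>h<n. [:- f h, 1:]) = n" "lead_coeff (\<Prod>h<n. [:- f h, 1:]) = 1"
proof -
  show "degree (\<Prod>h<n. [:- f h, 1:]) = n"
    by (subst degree_prod_sum_eq) auto
  show "lead_coeff (\<Prod>h<n. [:- f h, 1:]) = 1"
    by (simp only: lead_coeff_prod) simp
qed

lemma poly_linear_product:
  fixes f :: "nat \<Rightarrow> 'k::field"
  shows "poly (\<Prod>h<n. [:- f h, 1:]) x = (\<Prod>h<n. x - f h)"
  unfolding poly_prod by (rule prod.cong) simp_all

lemma degree_tau_poly: "degree (tau_poly \<theta> i) = i"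
  and lead_coeff_tau_poly: "lead_coeff (tau_poly \<theta> i) = 1"
  unfolding tau_poly_def by (rule monic_linear_product)+

lemma degree_eta_poly: "degree (eta_poly d \<theta> i) = i"
  and lead_coeff_eta_poly: "lead_coeff (eta_poly d \<theta> i) = 1"
  unfolding eta_poly_def by (rule monic_linear_product)+

lemma poly_tau_poly_zero_iff:
  assumes "inj_on \<theta> {..d}" "i \<le> d" "j \<le> d"
  shows "poly (tau_poly \<theta> i) (\<theta> j) = 0 \<longleftrightarrow> j < i"
  using assms by (auto simp: tau_poly_def poly_linear_product dest: inj_onD)

lemma poly_eta_poly_zero_iff:
  assumes "inj_on \<theta> {..d}" "i \<le> d" "j \<le> d"
  shows "poly (eta_poly d \<theta> i) (\<theta> j) = 0 \<longleftrightarrow> d - j < i"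
proof -
  have "poly (eta_poly d \<theta> i) (\<theta> j) = 0 \<longleftrightarrow> (\<exists>h<i. \<theta> j = \<theta> (d - h))"
    by (simp add: eta_poly_def poly_linear_product Bex_def)
  also have "\<dots> \<longleftrightarrow> (\<exists>h<i. j = d - h)"
    using assms by (auto dest: inj_onD)
  also have "\<dots> \<longleftrightarrow> d - j < i"
    using assms by (auto intro: exI[of _ "d - j"])
  finally show ?thesis .
qed

section \<open>Leonard systems\<close>

locale leonard =
  P: tridiagonal_pair sA tr d A E \<theta> As Es \<theta>s + Q: tridiagonal_pair sA tr d As Es \<theta>s A E \<theta>
  for sA :: "'k::field \<Rightarrow> 'a::ring_1 \<Rightarrow> 'a" and tr d A E \<theta> As Es \<theta>s +
  fixes dag :: "'a \<Rightarrow> 'a"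
  assumes dag: "antiautomorphism sA dag" and dag_A: "dag A = A" and dag_As: "dag As = As"
begin

lemma dag_mult: "dag (x * y) = dag y * dag x"
  using dag by (simp add: antiautomorphism_def)

lemma dag_nonzero:
  assumes "x \<noteq> 0"
  shows "dag x \<noteq> 0"
proof -
  interpret dag: Vector_Spaces.linear sA sA dag
    using dag by (simp add: antiautomorphism_def)
  have "inj dag"
    using dag by (simp add: antiautomorphism_def bij_def)
  then show ?thesis
    using assms dag.zero by (metis injD)
qed

lemma dag_E: "i \<le> d \<Longrightarrow> dag (E i) = E i"
  by (rule P.R.antiautomorphism_fixes_idem[OF dag dag_A])

lemma dag_Es: "i \<le> d \<Longrightarrow> dag (Es i) = Es i"
  by (rule P.S.antiautomorphism_fixes_idem[OF dag dag_As])

text \<open>The antiautomorphism swaps the factors, and reversal replaces \<open>E 0\<close> by \<open>E d\<close>.\<close>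

lemma end_products_nonzero:
  assumes "r \<le> d"
  shows "Es r * E 0 \<noteq> 0" "E 0 * Es r \<noteq> 0" "Es r * E d \<noteq> 0" "E d * Es r \<noteq> 0"
proof -
  show l: "Es r * E 0 \<noteq> 0" "Es r * E d \<noteq> 0"
    using P.cross_nonzero tridiagonal_pair.cross_nonzero[OF P.reversed] assms by auto
  show "E 0 * Es r \<noteq> 0" "E d * Es r \<noteq> 0"
    using l[THEN dag_nonzero] assms by (auto simp: dag_mult dag_E dag_Es)
qed

lemma tr_end_nonzero:
  assumes "r \<le> d"
  shows "tr (Es r * E 0) \<noteq> 0" "tr (Es r * E d) \<noteq> 0"
proof -
  have "E j * Es r * E j \<noteq> 0" if "j = 0 \<or> j = d" for j
    using that end_products_nonzero[OF assms] P.S.sandwich_nonzero[OF assms] by blast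
  then show "tr (Es r * E 0) \<noteq> 0" "tr (Es r * E d) \<noteq> 0"
    using P.R.idem_corner[of _ "Es r"] by (metis le0 order_refl P.R.scale_zero_left)+
qed

text \<open>These are the denominators in the split sequence. For \<open>i = 0\<close> the trace is \<open>1\<close>. Otherwise put \<open>T = \<tau>\<^sub>i(A)\<close> and
\<open>p(x) = (x - \<theta>*\<^sub>1) \<cdots> (x - \<theta>*\<^sub>i\<^sub>-\<^sub>1)\<close>. As \<open>T\<close> only involves \<open>E\<^sub>i, \<dots>, E\<^sub>d\<close> and
\<open>p\<close> has degree below \<open>i\<close>, the product \<open>E\<^sub>0 p(A*) T\<close> is zero. Expanded over the \<open>E*\<^sub>r\<close> and
multiplied by \<open>E*\<^sub>0\<close> on the right, it keeps (\<open>p\<close> vanishing at \<open>\<theta>*\<^sub>r\<close> for \<open>0 < r < i\<close>, and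
\<open>T\<close> being a polynomial of degree \<open>i\<close> in \<open>A\<close>) only the terms \<open>r = 0\<close> and \<open>r = i\<close>. If the trace were zero, so
would be the first of them, hence also the second; but that one is a product of nonzero factors through
\<open>E*\<^sub>i\<close>.\<close>

lemma tr_tau_nonzero:
  assumes i: "i \<le> d"
  shows "tr (alg_poly sA (tau_poly \<theta> i) A * Es 0) \<noteq> 0"
proof (cases "i = 0")
  case True
  then show ?thesis
    by (simp add: tau_poly_def alg_poly_def P.S.tr_idem)
next
  case False
  define T where "T = alg_poly sA (tau_poly \<theta> i) A"
  define p where "p = (\<Prod>h<i - 1. [:- \<theta>s (Suc h), 1:])"
  define Pp where "Pp = alg_poly sA p As"
  have p_nonzero: "poly p (\<theta>s i) \<noteq> 0"
    using i inj_onD[OF P.S.theta_inj] by (fastforce simp: p_def poly_linear_product)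
  have p_zero: "poly p (\<theta>s r) = 0" if "0 < r" "r < i" for r
    using that by (auto simp: p_def poly_linear_product intro!: bexI[of _ "r - 1"])
  \<comment> \<open>The paths through \<open>E m\<close> die for small \<open>m\<close> in \<open>T\<close>, for the others in \<open>p(A*)\<close>.\<close>
  have left: "E 0 * Pp * T = 0"
  proof -
    have "E 0 * Pp * E m * T = 0" if m: "m \<le> d" for m
    proof (cases "m < i")
      case True
      then have "E m * T = 0"
        using i m by (simp add: T_def P.R.idem_alg_poly poly_tau_poly_zero_iff[OF P.R.theta_inj])
      then show ?thesis
        by (simp add: mult.assoc)
    next
      case False
      then have "E 0 * Pp * E m = 0"
        using m \<open>i \<noteq> 0\<close> unfolding Pp_def p_def
        by (intro P.poly_far) (auto simp: monic_linear_product)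
      then show ?thesis
        by simp
    qed
    then show ?thesis
      using P.R.insert_idem_sum[of "E 0 * Pp" T] by simp
  qed
  show ?thesis
  proof
    assume "tr (alg_poly sA (tau_poly \<theta> i) A * Es 0) = 0"
    then have corner: "Es 0 * (T * Es 0) = 0"
      using P.S.idem_corner[of 0 T] by (simp add: T_def mult.assoc)
    have other: "E 0 * Pp * Es r * (T * Es 0) = 0" if r: "r \<le> d" "r \<noteq> i" for r
    proof -
      consider "r = 0" | "0 < r" "r < i" | "i < r"
        using r by linarith
      then show ?thesis
      proof cases
        case 1
        then show ?thesis
          using corner by (simp add: mult.assoc)
      next
        case 2
        then have "Pp * Es r = 0"
          using r by (simp add: Pp_def P.S.alg_poly_idem p_zero)
        then show ?thesis
          by (simp add: mult.assoc)
      next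
        case 3
        then have "Es r * T * Es 0 = 0"
          using r unfolding T_def by (intro Q.poly_far) (auto simp: degree_tau_poly)
        then show ?thesis
          by (simp add: mult.assoc)
      qed
    qed
    have "0 = E 0 * Pp * (T * Es 0)"
      using left by (simp flip: mult.assoc)
    also have "\<dots> = (\<Sum>r\<le>d. E 0 * Pp * Es r * (T * Es 0))"
      by (rule P.S.insert_idem_sum)
    also have "\<dots> = (\<Sum>r\<le>d. if r = i then E 0 * Pp * Es i * (T * Es 0) else 0)"
      by (rule sum.cong) (auto simp: other)
    also have "\<dots> = E 0 * (Pp * Es i) * (T * Es 0)"
      using i by (simp add: mult.assoc)
    also have "\<dots> = sA (poly p (\<theta>s i)) (E 0 * Es i * (T * Es 0))"
      using i by (simp add: Pp_def P.S.alg_poly_idem P.R.scale_mult_left P.R.scale_mult_right)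
    finally have "E 0 * Es i * (T * Es 0) = 0"
      using p_nonzero by simp
    moreover have "Es i * (T * Es 0) \<noteq> 0"
      using Q.power_corner_nonzero[OF i] i
        Q.poly_top[of i 0 "tau_poly \<theta> i"] degree_tau_poly[of \<theta> i] lead_coeff_tau_poly[of \<theta> i]
      by (simp add: T_def mult.assoc)
    ultimately show False
      using P.S.sandwich_nonzero[OF i, of "E 0"] end_products_nonzero(2)[OF i] by blast
  qed
qed

text \<open>The four polynomials of degree \<open>d\<close> vanish at all eigenvalues but one, which makes them multiples of the idempotents
at the ends.\<close>

lemma tau_A_top: "alg_poly sA (tau_poly \<theta> d) A = sA (poly (tau_poly \<theta> d) (\<theta> d)) (E d)"
  by (rule P.R.alg_poly_single) (auto simp: poly_tau_poly_zero_iff[OF P.R.theta_inj])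

lemma eta_A_top: "alg_poly sA (eta_poly d \<theta> d) A = sA (poly (eta_poly d \<theta> d) (\<theta> 0)) (E 0)"
  by (rule P.R.alg_poly_single) (auto simp: poly_eta_poly_zero_iff[OF P.R.theta_inj])

lemma tau_As_top: "alg_poly sA (tau_poly \<theta>s d) As = sA (poly (tau_poly \<theta>s d) (\<theta>s d)) (Es d)"
  by (rule P.S.alg_poly_single) (auto simp: poly_tau_poly_zero_iff[OF P.S.theta_inj])

lemma eta_As_top: "alg_poly sA (eta_poly d \<theta>s d) As = sA (poly (eta_poly d \<theta>s d) (\<theta>s 0)) (Es 0)"
  by (rule P.S.alg_poly_single) (auto simp: poly_eta_poly_zero_iff[OF P.S.theta_inj])

text \<open>With \<open>\<tau>\<^sub>d(A)\<close> a multiple of \<open>E\<^sub>d\<close>, the factor \<open>\<tau>*\<^sub>d(A*)\<close> in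
\<open>E*\<^sub>0 \<tau>\<^sub>d(A) \<tau>*\<^sub>d(A*) E\<^sub>0\<close> stands between \<open>E\<^sub>d\<close> and \<open>E\<^sub>0\<close> and may be replaced by
\<open>\<eta>*\<^sub>d(A*)\<close>, a multiple of \<open>E*\<^sub>0\<close>. Likewise \<open>\<tau>\<^sub>d(A)\<close> stands between \<open>E*\<^sub>0\<close> and
\<open>E*\<^sub>d\<close> and may be replaced by \<open>\<eta>\<^sub>d(A)\<close>, a multiple of \<open>E\<^sub>0\<close>. By the corner laws both
results are multiples of the nonzero element \<open>E*\<^sub>0 E\<^sub>0\<close>, and the factors must agree.\<close>

lemma corner_trace_exchange:
  "poly (tau_poly \<theta> d) (\<theta> d) * poly (eta_poly d \<theta>s d) (\<theta>s 0) * tr (E d * Es 0) =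
   poly (eta_poly d \<theta> d) (\<theta> 0) * poly (tau_poly \<theta>s d) (\<theta>s d) * tr (Es d * E 0)"
proof -
  define a b as bs where ab: "a = poly (tau_poly \<theta> d) (\<theta> d)" "b = poly (eta_poly d \<theta> d) (\<theta> 0)"
    "as = poly (tau_poly \<theta>s d) (\<theta>s d)" "bs = poly (eta_poly d \<theta>s d) (\<theta>s 0)"
  have tau: "degree (tau_poly f d) = d" "coeff (tau_poly f d) d = 1"
    and eta: "degree (eta_poly d f d) = d" "coeff (eta_poly d f d) d = 1" for f :: "nat \<Rightarrow> 'k"
    using lead_coeff_tau_poly[of f d] lead_coeff_eta_poly[of d f d]
    by (simp_all add: degree_tau_poly degree_eta_poly)
  have "E d * alg_poly sA (tau_poly \<theta>s d) As * E 0 = E d * alg_poly sA (eta_poly d \<theta>s d) As * E 0"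
    using P.poly_top[of d 0 "tau_poly \<theta>s d"] P.poly_top[of d 0 "eta_poly d \<theta>s d"]
    by (simp add: tau eta)
  then have 1: "sA as (E d * Es d * E 0) = sA bs (E d * Es 0 * E 0)"
    by (simp add: tau_As_top eta_As_top ab P.R.scale_mult_left P.R.scale_mult_right)
  have "Es 0 * alg_poly sA (tau_poly \<theta> d) A * Es d = Es 0 * alg_poly sA (eta_poly d \<theta> d) A * Es d"
    using Q.poly_top[of 0 d "tau_poly \<theta> d"] Q.poly_top[of 0 d "eta_poly d \<theta> d"]
    by (simp add: tau eta)
  then have 2: "sA a (Es 0 * E d * Es d) = sA b (Es 0 * E 0 * Es d)"
    by (simp add: tau_A_top eta_A_top ab P.R.scale_mult_left P.R.scale_mult_right)
  have "sA (a * bs * tr (E d * Es 0)) (Es 0 * E 0) = sA (a * bs) (Es 0 * E d * Es 0 * E 0)"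
    by (simp add: P.S.idem_corner P.R.scale_mult_left)
  also have "\<dots> = sA a (Es 0 * sA bs (E d * Es 0 * E 0))"
    by (simp add: P.R.scale_mult_right mult.assoc)
  also have "\<dots> = sA a (Es 0 * sA as (E d * Es d * E 0))"
    by (simp only: 1)
  also have "\<dots> = sA as (sA a (Es 0 * E d * Es d) * E 0)"
    by (simp add: P.R.scale_mult_left P.R.scale_mult_right mult.assoc mult.commute[of as])
  also have "\<dots> = sA as (sA b (Es 0 * E 0 * Es d) * E 0)"
    by (simp only: 2)
  also have "\<dots> = sA (b * as) (Es 0 * (E 0 * Es d * E 0))"
    by (simp add: P.R.scale_mult_left mult.assoc mult.commute[of as])
  also have "\<dots> = sA (b * as * tr (Es d * E 0)) (Es 0 * E 0)"
    by (simp add: P.R.idem_corner P.R.scale_mult_right)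
  finally show ?thesis
    using end_products_nonzero(1)[of 0] by (simp add: ab)
qed

text \<open>The quotients of traces telescope to \<open>tr(\<tau>\<^sub>d(A) E*\<^sub>0)\<close>, and the differences
\<open>\<theta>*\<^sub>0 - \<theta>*\<^sub>j\<close> multiply to \<open>\<eta>*\<^sub>d(\<theta>*\<^sub>0)\<close>.\<close>

lemma split_sequence_product:
  assumes \<phi>: "\<And>i. i \<in> {1..d} \<Longrightarrow> \<phi> i = (\<theta>s 0 - \<theta>s i) *
        (tr (alg_poly sA (tau_poly \<theta> i) A * Es 0) /
         tr (alg_poly sA (tau_poly \<theta> (i - 1)) A * Es 0))"
  shows "(\<Prod>j=1..d. \<phi> j) =
    poly (eta_poly d \<theta> d) (\<theta> 0) * poly (tau_poly \<theta>s d) (\<theta>s d) * tr (Es d * E 0)"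
proof -
  define t where "t i = tr (alg_poly sA (tau_poly \<theta> i) A * Es 0)" for i
  have t0: "t 0 = 1"
    by (simp add: t_def tau_poly_def alg_poly_def P.S.tr_idem)
  have "n \<le> d \<Longrightarrow> (\<Prod>j=1..n. \<phi> j) = (\<Prod>j=1..n. \<theta>s 0 - \<theta>s j) * t n" for n
  proof (induction n)
    case (Suc n)
    then show ?case
      using \<phi>[of "Suc n"] tr_tau_nonzero[of n] by (simp add: t_def)
  qed (simp add: t0)
  then have "(\<Prod>j=1..d. \<phi> j) = (\<Prod>j=1..d. \<theta>s 0 - \<theta>s j) * t d"
    by simp
  moreover have "(\<Prod>j=1..d. \<theta>s 0 - \<theta>s j) = poly (eta_poly d \<theta>s d) (\<theta>s 0)"
    unfolding eta_poly_def poly_linear_product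
    by (rule prod.reindex_bij_witness[of _ "\<lambda>h. d - h" "\<lambda>j. d - j"]) auto
  moreover have "t d = poly (tau_poly \<theta> d) (\<theta> d) * tr (E d * Es 0)"
    by (simp add: t_def tau_A_top P.R.scale_mult_left P.R.tr_scale)
  ultimately show ?thesis
    using corner_trace_exchange by (simp add: mult_ac)
qed

text \<open>At \<open>A*\<close> the monic polynomial \<open>\<tau>*\<^sub>i \<eta>*\<^sub>d\<^sub>-\<^sub>i\<close> of degree \<open>d\<close> is a multiple of \<open>E*\<^sub>i\<close>, and
between \<open>E\<^sub>0\<close> and \<open>E\<^sub>d\<close> only its leading term counts. As the right-hand side does not
depend on \<open>i\<close>, this lets \<open>E\<^sub>0 E*\<^sub>i E\<^sub>d\<close> be computed from the case \<open>i = d\<close>.\<close>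

lemma end_sandwich:
  assumes "i \<le> d"
  shows "sA (poly (tau_poly \<theta>s i) (\<theta>s i) * poly (eta_poly d \<theta>s (d - i)) (\<theta>s i)) (E 0 * Es i * E d) =
    E 0 * As ^ d * E d"
proof -
  define p where "p = tau_poly \<theta>s i * eta_poly d \<theta>s (d - i)"
  have lead: "lead_coeff p = 1"
    unfolding p_def by (simp only: lead_coeff_mult lead_coeff_tau_poly lead_coeff_eta_poly) simp
  have deg: "degree p = d"
    unfolding p_def using assms lead_coeff_tau_poly[of \<theta>s i] lead_coeff_eta_poly[of d \<theta>s "d - i"]
    by (subst degree_mult_eq) (auto simp: degree_tau_poly degree_eta_poly)
  have "alg_poly sA p As = sA (poly p (\<theta>s i)) (Es i)"
    using assms by (intro P.S.alg_poly_single)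
      (auto simp: p_def poly_tau_poly_zero_iff[OF P.S.theta_inj] poly_eta_poly_zero_iff[OF P.S.theta_inj])
  moreover have "E 0 * alg_poly sA p As * E d = E 0 * As ^ d * E d"
    using P.poly_top[of 0 d p] lead deg by simp
  ultimately show ?thesis
    by (simp add: p_def P.R.scale_mult_left P.R.scale_mult_right)
qed

end

section \<open>The module and its bilinear form\<close>

context algebra_module
begin

lemma act_zero: "act 0 v = 0"
  using act_add[of 0 0 v] by simp

lemma act_scale_right: "act x (sV c v) = sV c (act x v)"
  using act_linear[of x] unfolding Vector_Spaces.linear_iff by blast

end

lemma (in irreducible_module) cyclic:
  assumes v: "v \<noteq> 0"
  obtains Z where "act Z v = w"
proof -
  have "range (\<lambda>Z. act Z v) = {0} \<or> range (\<lambda>Z. act Z v) = UNIV"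
  proof (rule no_proper_submodule)
    show "V.subspace (range (\<lambda>Z. act Z v))"
      unfolding V.subspace_def
      by (auto simp flip: act_add act_scale act_zero[of v])
    show "act x u \<in> range (\<lambda>Z. act Z v)" if "u \<in> range (\<lambda>Z. act Z v)" for x u
      using that by (auto simp flip: act_mult)
  qed
  moreover have "v \<in> range (\<lambda>Z. act Z v)"
    using act_one by (metis rangeI)
  ultimately show ?thesis
    using v that by (metis UNIV_I image_iff singletonD)
qed

locale leonard_module =
  leonard sA tr d A E \<theta> As Es \<theta>s dag + irreducible_module sA sV act
  for sA :: "'k::field \<Rightarrow> 'a::ring_1 \<Rightarrow> 'a" and tr d A E \<theta> As Es \<theta>s dag
    and sV :: "'k \<Rightarrow> 'v::ab_group_add \<Rightarrow> 'v" and act +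
  fixes B :: "'v \<Rightarrow> 'v \<Rightarrow> 'k"
  assumes bilinear: "bilinear_form sV B"
    and form_nonzero: "\<exists>u v. B u v \<noteq> 0"
    and adjoint: "B (act X u) v = B u (act (dag X) v)"
begin

lemma form_scale: "B (sV c u) v = c * B u v"
  using bilinear unfolding bilinear_form_def Vector_Spaces.linear_iff by blast

text \<open>The vectors that pair to zero with everything form a submodule, because the antiautomorphism is onto.\<close>

lemma form_nondegenerate:
  assumes v: "v \<noteq> 0"
  obtains u where "B u v \<noteq> 0"
proof (rule ccontr)
  assume "\<not> thesis"
  then have zero: "B u v = 0" for u
    using that by blast
  have "B u w = 0" for u w
  proof -
    obtain Z where Z: "act Z v = w"
      using cyclic[OF v] .
    obtain Y where "Z = dag Y"
      using dag by (metis antiautomorphism_def bij_def surjD)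
    then show ?thesis
      using adjoint[of Y u v] zero Z by simp
  qed
  then show False
    using form_nonzero by blast
qed

text \<open>Together these properties make \<open>e\<close> the projection onto a line that is orthogonal for the form,
whichever of the two families it belongs to.\<close>

definition rank_one_projection :: "'a \<Rightarrow> bool" where
  "rank_one_projection e \<longleftrightarrow>
     e * e = e \<and> dag e = e \<and> (\<forall>X. e * X * e = sA (tr (X * e)) e)"

lemma rank_one_projection_E: "i \<le> d \<Longrightarrow> rank_one_projection (E i)"
  by (simp add: rank_one_projection_def P.R.idem_orth dag_E P.R.idem_corner)

lemma rank_one_projection_Es: "i \<le> d \<Longrightarrow> rank_one_projection (Es i)"
  by (simp add: rank_one_projection_def P.S.idem_orth dag_Es P.S.idem_corner)

lemma projection_fixes:
  "rank_one_projection e \<Longrightarrow> v \<in> range (act e) \<Longrightarrow> act e v = v"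
  by (auto simp: rank_one_projection_def simp flip: act_mult)

lemma projection_act:
  assumes e: "rank_one_projection e" and v: "v \<in> range (act e)"
  shows "act e (act X v) = sV (tr (X * e)) v"
proof -
  have "act e (act X v) = act (e * X * e) v"
    using projection_fixes[OF assms] by (simp add: act_mult)
  also have "\<dots> = sV (tr (X * e)) v"
    using e projection_fixes[OF assms] by (simp add: rank_one_projection_def act_scale)
  finally show ?thesis .
qed

text \<open>The image of \<open>e\<close> is the line through \<open>v\<close>: any \<open>u\<close> is \<open>Z v\<close> for some \<open>Z\<close>, and the corner law gives
\<open>e Z v\<close>. Pairing \<open>e u = c v\<close> with \<open>v\<close> yields \<open>\<langle>u,v\<rangle> = c \<langle>v,v\<rangle>\<close>, so that
\<open>\<langle>v,v\<rangle> = 0\<close> would contradict nondegeneracy.\<close>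

lemma
  assumes e: "rank_one_projection e" and v: "v \<in> range (act e)" "v \<noteq> 0"
  shows form_self_nonzero: "B v v \<noteq> 0"
    and projection_formula: "act e u = sV (B u v / B v v) v"
proof -
  have coeff: "B u v = c * B v v" if "act e u = sV c v" for u c
  proof -
    have "B u v = B (act e u) v"
      using e projection_fixes[OF e v(1)] by (simp add: adjoint rank_one_projection_def)
    then show ?thesis
      using that by (simp add: form_scale)
  qed
  have line: "\<exists>c. act e u = sV c v" for u
    using cyclic[OF v(2), of u] projection_act[OF e v(1)] by metis
  show nz: "B v v \<noteq> 0"
    using form_nondegenerate[OF v(2)] line coeff by (metis mult_zero_right)
  obtain c where c: "act e u = sV c v"
    using line by blast
  show "act e u = sV (B u v / B v v) v"
    using c coeff[OF c] nz by simp
qed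

text \<open>If \<open>\<langle>v,w\<rangle> = 0\<close>, then \<open>f v = 0\<close>, whereas \<open>e f v = tr(f e) v\<close>.\<close>

lemma form_cross_nonzero:
  assumes e: "rank_one_projection e" and v: "v \<in> range (act e)" "v \<noteq> 0"
    and f: "rank_one_projection f" and w: "w \<in> range (act f)" "w \<noteq> 0"
    and t: "tr (f * e) \<noteq> 0"
  shows "B v w \<noteq> 0"
proof
  assume "B v w = 0"
  then have "act f v = 0"
    using projection_formula[OF f w, of v] by simp
  then have "sV (tr (f * e)) v = 0"
    using projection_act[OF e v(1), of f] act_scale_right[of e 0 0] by simp
  then show False
    using t v(2) by simp
qed

lemma sum_collapse:
  assumes i: "i \<le> d"
  shows "act (\<Sum>r\<le>d. sA (c r) (Y r * Es r)) (act (Es i) v) = sV (c i) (act (Y i) (act (Es i) v))"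
proof -
  have "(\<Sum>r\<le>d. sA (c r) (Y r * Es r)) * Es i =
      (\<Sum>r\<le>d. if r = i then sA (c i) (Y i * Es i) else 0)"
    unfolding sum_distrib_right
    by (rule sum.cong) (auto simp: i P.R.scale_mult_left P.S.idem_orth mult.assoc)
  then have "(\<Sum>r\<le>d. sA (c r) (Y r * Es r)) * Es i = sA (c i) (Y i * Es i)"
    using i by simp
  then show ?thesis
    by (metis act_mult act_scale)
qed

context
  fixes \<xi>d :: 'v
  assumes \<xi>d: "\<xi>d \<in> range (act (E d))" "\<xi>d \<noteq> 0"
begin

lemma transition_from_end:
  assumes i: "i \<le> d"
  shows "act (\<Sum>r\<le>d. sA (1 / tr (Es r * E d)) (Y r * E d * Es r)) (act (Es i) \<xi>d) = act (Y i) \<xi>d"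
  using sum_collapse[OF i, of "\<lambda>r. 1 / tr (Es r * E d)" "\<lambda>r. Y r * E d" \<xi>d]
    projection_act[OF rank_one_projection_E[of d] \<xi>d(1), of "Es i"] tr_end_nonzero(2)[OF i]
  by (simp add: act_mult act_scale_right)

lemma transition_to_dual:
  assumes i: "i \<le> d" and k: "k \<le> d" and \<xi>: "\<xi> \<in> range (act (Es k))" "\<xi> \<noteq> 0"
  shows "act (sA (B \<xi> \<xi> / B \<xi>d \<xi>)
      (\<Sum>r\<le>d. sA (1 / tr (Es r * E d)) (Y r * Es k * E d * Es r))) (act (Es i) \<xi>d) = act (Y i) \<xi>"
proof -
  have "B \<xi> \<xi> \<noteq> 0"
    by (rule form_self_nonzero[OF rank_one_projection_Es[OF k] \<xi>])
  moreover have "B \<xi>d \<xi> \<noteq> 0"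
    using form_cross_nonzero[OF rank_one_projection_E \<xi>d rank_one_projection_Es \<xi>]
      tr_end_nonzero(2) k by blast
  moreover have "act (Es k) \<xi>d = sV (B \<xi>d \<xi> / B \<xi> \<xi>) \<xi>"
    by (rule projection_formula[OF rank_one_projection_Es[OF k] \<xi>])
  ultimately show ?thesis
    using transition_from_end[OF i, of "\<lambda>r. Y r * Es k"]
    by (simp add: act_scale act_mult act_scale_right)
qed

text \<open>By \<open>end_sandwich\<close> the coefficient of \<open>E\<^sub>0 E*\<^sub>i \<xi>\<^sub>d\<close> can be found at \<open>i = d\<close>. There \<open>\<xi>\<^sub>d\<close> is
projected to a multiple of \<open>\<xi>\<close> and then to one of \<open>\<xi>\<^sub>0\<close>; the second factor follows by
comparing \<open>E\<^sub>0 E*\<^sub>d \<xi>\<^sub>0 = tr(E*\<^sub>d E\<^sub>0) \<xi>\<^sub>0\<close> with the projection formula for \<open>E*\<^sub>d \<xi>\<^sub>0\<close>.\<close>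

lemma transition_to_opposite_end:
  assumes i: "i \<le> d"
    and \<xi>0: "\<xi>0 \<in> range (act (E 0))" "\<xi>0 \<noteq> 0"
    and \<xi>: "\<xi> \<in> range (act (Es d))" "\<xi> \<noteq> 0"
    and \<phi>: "\<And>i. i \<in> {1..d} \<Longrightarrow> \<phi> i = (\<theta>s 0 - \<theta>s i) *
        (tr (alg_poly sA (tau_poly \<theta> i) A * Es 0) /
         tr (alg_poly sA (tau_poly \<theta> (i - 1)) A * Es 0))"
  shows "act (sA (poly (eta_poly d \<theta> d) (\<theta> 0) / (\<Prod>j=1..d. \<phi> j) * (B \<xi>0 \<xi> / B \<xi>d \<xi>))
      (\<Sum>r\<le>d. sA (poly (tau_poly \<theta>s r) (\<theta>s r) * poly (eta_poly d \<theta>s (d - r)) (\<theta>s r))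
        (Y r * E 0 * Es r))) (act (Es i) \<xi>d) = act (Y i) \<xi>0"
proof -
  define c where "c r = poly (tau_poly \<theta>s r) (\<theta>s r) * poly (eta_poly d \<theta>s (d - r)) (\<theta>s r)" for r
  define b where "b = poly (eta_poly d \<theta> d) (\<theta> 0)"
  define t where "t = tr (Es d * E 0)"
  have c_d: "c d = poly (tau_poly \<theta>s d) (\<theta>s d)"
    by (simp add: c_def eta_poly_def)
  have nz: "b \<noteq> 0" "c d \<noteq> 0" "t \<noteq> 0"
    using tr_end_nonzero(1)[of d]
    by (auto simp: b_def c_d t_def poly_eta_poly_zero_iff[OF P.R.theta_inj]
        poly_tau_poly_zero_iff[OF P.S.theta_inj])
  have prod: "(\<Prod>j=1..d. \<phi> j) = b * c d * t"
    using split_sequence_product[OF \<phi>] by (simp add: b_def c_d t_def)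
  have forms: "B \<xi> \<xi> \<noteq> 0" "B \<xi>d \<xi> \<noteq> 0" "B \<xi>0 \<xi> \<noteq> 0"
    using form_self_nonzero[OF rank_one_projection_Es \<xi>]
      form_cross_nonzero[OF rank_one_projection_E \<xi>d rank_one_projection_Es \<xi>]
      form_cross_nonzero[OF rank_one_projection_E \<xi>0 rank_one_projection_Es \<xi>]
      tr_end_nonzero[of d] by auto
  have on_dual: "act (Es d) u = sV (B u \<xi> / B \<xi> \<xi>) \<xi>" for u
    using \<xi> by (intro projection_formula rank_one_projection_Es) auto
  have E0_\<xi>: "act (E 0) \<xi> = sV (t * B \<xi> \<xi> / B \<xi>0 \<xi>) \<xi>0"
  proof -
    have "sV (B \<xi>0 \<xi> / B \<xi> \<xi>) (act (E 0) \<xi>) = sV t \<xi>0"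
      using projection_act[OF rank_one_projection_E[of 0] \<xi>0(1), of "Es d"]
      by (simp add: on_dual act_scale_right t_def)
    then have "sV (B \<xi> \<xi> / B \<xi>0 \<xi>) (sV (B \<xi>0 \<xi> / B \<xi> \<xi>) (act (E 0) \<xi>)) =
        sV (B \<xi> \<xi> / B \<xi>0 \<xi>) (sV t \<xi>0)"
      by simp
    then show ?thesis
      using forms by (simp add: mult.commute)
  qed
  have "sV (c i) (act (E 0) (act (Es i) \<xi>d)) = act (sA (c i) (E 0 * Es i * E d)) \<xi>d"
    using projection_fixes[OF rank_one_projection_E \<xi>d(1)] by (simp add: act_scale act_mult)
  also have "sA (c i) (E 0 * Es i * E d) = sA (c d) (E 0 * Es d * E d)"
    using end_sandwich[OF i] end_sandwich[of d] by (simp add: c_def)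
  also have "act \<dots> \<xi>d = sV (c d) (act (E 0) (act (Es d) \<xi>d))"
    using projection_fixes[OF rank_one_projection_E \<xi>d(1)] by (simp add: act_scale act_mult)
  also have "\<dots> = sV (c d * t * B \<xi>d \<xi> / B \<xi>0 \<xi>) \<xi>0"
    using forms by (simp add: on_dual act_scale_right E0_\<xi>)
  finally have step: "sV (c i) (act (E 0) (act (Es i) \<xi>d)) = sV (c d * t * B \<xi>d \<xi> / B \<xi>0 \<xi>) \<xi>0" .
  have "act (sA (b / (b * c d * t) * (B \<xi>0 \<xi> / B \<xi>d \<xi>)) (\<Sum>r\<le>d. sA (c r) (Y r * E 0 * Es r)))
      (act (Es i) \<xi>d) =
      sV (b / (b * c d * t) * (B \<xi>0 \<xi> / B \<xi>d \<xi>)) (act (Y i) (sV (c i) (act (E 0) (act (Es i) \<xi>d))))"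
    using sum_collapse[OF i, of c "\<lambda>r. Y r * E 0" \<xi>d]
    by (simp add: act_scale act_mult act_scale_right)
  also have "\<dots> = act (Y i) \<xi>0"
    using nz forms by (simp add: step act_scale_right)
  finally show ?thesis
    by (simp only: prod b_def c_def)
qed

end

end

section \<open>Matrices\<close>

text \<open>Pairing with a matrix unit extracts a single entry, which gives nondegeneracy.\<close>

lemma trace_algebra_alg_trace:
  fixes \<rho> :: "'a::ring_1 \<Rightarrow> 'k::field^'n^'n"
  assumes "assoc_algebra sA" and \<rho>: "matrix_algebra_iso sA \<rho>"
  shows "trace_algebra sA (alg_trace \<rho>)"
proof -
  interpret assoc_algebra sA by fact
  have inj: "inj \<rho>" and surj: "surj \<rho>" and mult: "\<And>x y. \<rho> (x * y) = \<rho> x ** \<rho> y"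
    using \<rho> by (auto simp: matrix_algebra_iso_def bij_def)
  show ?thesis
  proof
    have scale: "\<rho> (sA c x) = (\<chi> i j. c * \<rho> x $ i $ j)" for c x
      using \<rho> unfolding matrix_algebra_iso_def by blast
    show "alg_trace \<rho> (sA c x) = c * alg_trace \<rho> x" for c x
      by (simp add: scale alg_trace_def trace_def sum_distrib_left)
    show "x = 0" if zero: "\<And>z. alg_trace \<rho> (z * x) = 0" for x
    proof -
      have "\<rho> x $ i $ j = 0" for i j
      proof -
        have delta: "(if c then 1 else 0) * u = (if c then u else 0)" for c and u :: 'k
          by simp
        \<comment> \<open>The matrix unit with its one at row \<open>j\<close> and column \<open>i\<close>.\<close>
        obtain z where z: "\<rho> z = (\<chi> k l. if k = j then if l = i then 1 else 0 else 0)"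
          using surj by (metis surjD)
        have "alg_trace \<rho> (z * x) = (\<Sum>k\<in>UNIV. \<Sum>l\<in>UNIV. \<rho> z $ k $ l * \<rho> x $ l $ k)"
          by (simp add: mult alg_trace_def trace_def matrix_matrix_mult_def)
        also have "\<dots> = (\<Sum>k\<in>UNIV. if k = j then \<rho> x $ i $ j else 0)"
          by (rule sum.cong) (auto simp: z delta)
        finally show ?thesis
          using zero by simp
      qed
      then have "\<rho> x = 0"
        by (simp add: vec_eq_iff)
      moreover have "\<rho> 0 = 0"
        using scale[of 0 0] by (simp add: vec_eq_iff)
      ultimately show ?thesis
        using inj by (metis injD)
    qed
  qed
qed

text \<open>The eigenvalues are given on the abstract module, while the trace lives on matrices. An eigenvalue \<open>t\<close> on the
module makes \<open>X - t\<close> singular in the algebra and hence as a matrix, so the matrix of \<open>X\<close> has \<open>d + 1\<close>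
distinct eigenvalues and a basis of eigenvectors \<open>x\<^sub>0, \<dots>, x\<^sub>d\<close>. On this basis the product that defines
\<open>E\<^sub>i\<close> acts as the projection to \<open>x\<^sub>i\<close>. All identities are checked there, except the corner law, for which
\<open>E\<^sub>i\<close> is written as the outer product of \<open>x\<^sub>i\<close> and a row \<open>a\<close>.\<close>

lemma eigen_resolution_of_idempotent_ordering:
  fixes \<rho> :: "'a::ring_1 \<Rightarrow> 'k::field^'n^'n"
  assumes module: "algebra_module sA sV act" and \<rho>: "matrix_algebra_iso sA \<rho>"
    and card: "CARD('n) = d + 1" and ord: "idempotent_ordering d sA sV act X E \<theta>"
  shows "eigen_resolution sA (alg_trace \<rho>) d X E \<theta>"
proof -
  interpret algebra_module sA sV act by fact
  interpret trace_algebra sA "alg_trace \<rho>"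
    by (rule trace_algebra_alg_trace[OF alg.assoc_algebra_axioms \<rho>])
  have inj: "inj \<rho>" and surj: "surj \<rho>" and one: "\<rho> 1 = mat 1" and add: "\<And>x y. \<rho> (x + y) = \<rho> x + \<rho> y"
    and mult: "\<And>x y. \<rho> (x * y) = \<rho> x ** \<rho> y"
    using \<rho> by (auto simp: matrix_algebra_iso_def bij_def)
  have eqI: "x = y" if "\<And>v. \<rho> x *v v = \<rho> y *v v" for x y
    using that inj matrix_eq[of "\<rho> x" "\<rho> y"] by (metis injD)
  have zero: "\<rho> 0 = 0"
    using add[of 0 0] by simp
  have diff: "\<rho> (x - y) = \<rho> x - \<rho> y" for x y
    using add[of "x - y" y] by simp
  have scale: "\<rho> (sA c x) *v v = c *s (\<rho> x *v v)" for c x v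
    using \<rho> by (simp add: matrix_algebra_iso_def matrix_vector_mult_def vec_eq_iff
        sum_distrib_left mult.assoc)
  have sum: "\<rho> (\<Sum>i\<in>S. f i) *v v = (\<Sum>i\<in>S. \<rho> (f i) *v v)" for f :: "nat \<Rightarrow> 'a" and S v
    by (induction S rule: infinite_finite_induct)
      (auto simp: zero add matrix_vector_mult_add_rdistrib)
  have theta_inj: "inj_on \<theta> {..d}" and eigen: "\<And>i. i \<le> d \<Longrightarrow> \<theta> i \<in> eigenvalues sV act X"
    and E: "\<And>i. i \<le> d \<Longrightarrow> E i = primitive_idempotent d sA X \<theta> i"
    using ord by (auto simp: idempotent_ordering_def bij_betw_def)
  have "\<exists>x. x \<noteq> 0 \<and> \<rho> X *v x = \<theta> i *s x" if i: "i \<le> d" for i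
  proof (rule ccontr)
    assume no: "\<not> ?thesis"
    obtain v where v: "v \<noteq> 0" "act X v = sV (\<theta> i) v"
      using eigen[OF i] by (auto simp: eigenvalues_def)
    define Y where "Y = X - sA (\<theta> i) 1"
    have "\<rho> Y *v x = \<rho> X *v x - \<theta> i *s x" for x
      by (simp add: Y_def diff matrix_vector_mult_diff_rdistrib scale one)
    then have "\<forall>x. \<rho> Y *v x = 0 \<longrightarrow> x = 0"
      using no by auto
    then obtain N where "N ** \<rho> Y = mat 1"
      using matrix_left_invertible_ker[of "\<rho> Y"] by auto
    moreover obtain Z where "N = \<rho> Z"
      using surj by (rule surjE)
    ultimately have "Z * Y = 1"
      using inj by (metis mult one injD)
    moreover have "act X v = act Y v + act (sA (\<theta> i) 1) v"
      by (simp add: Y_def flip: act_add)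
    then have "act Y v = 0"
      by (simp add: v act_scale act_one)
    ultimately show False
      using v(1) act_mult[of Z Y v] act_scale_right[of Z 0 0] by (simp add: act_one)
  qed
  then obtain x where x: "\<And>i. i \<le> d \<Longrightarrow> x i \<noteq> 0" "\<And>i. i \<le> d \<Longrightarrow> \<rho> X *v x i = \<theta> i *s x i"
    by metis
  \<comment> \<open>The Lagrange factors act as scalars on every eigenvector.\<close>
  have factors: "\<rho> (prod_list (map (\<lambda>l. sA (c l) (X - sA (\<theta> l) 1)) ls)) *v x j =
      prod_list (map (\<lambda>l. c l * (\<theta> j - \<theta> l)) ls) *s x j" if "j \<le> d" for c ls j
  proof (induction ls)
    case (Cons l ls)
    then show ?case
      using that by (simp add: mult scale diff one x(2) vector_scalar_commute algebra_simps
          flip: matrix_vector_mul_assoc)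
  qed (simp add: one)
  have E_x: "\<rho> (E i) *v x j = (if i = j then x j else 0)" if "i \<le> d" "j \<le> d" for i j
  proof -
    define ls where "ls = filter (\<lambda>l. l \<noteq> i) [0..<Suc d]"
    have mem: "l \<in> set ls \<longleftrightarrow> l \<le> d \<and> l \<noteq> i" for l
      by (auto simp: ls_def)
    have "prod_list (map (\<lambda>l. 1 / (\<theta> i - \<theta> l) * (\<theta> j - \<theta> l)) ls) = (if i = j then 1 else 0)"
    proof (cases "i = j")
      case True
      have "map (\<lambda>l. 1 / (\<theta> i - \<theta> l) * (\<theta> j - \<theta> l)) ls = map (\<lambda>l. 1) ls"
        using True that theta_inj by (intro map_cong) (auto simp: mem dest: inj_onD)
      then show ?thesis
        using True by (simp only: map_replicate_const) simp
    next
      case False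
      then have "j \<in> set ls"
        using that by (simp add: mem)
      then show ?thesis
        using False by (force simp: prod_list_zero_iff)
    qed
    then show ?thesis
      using that factors[of j "\<lambda>l. 1 / (\<theta> i - \<theta> l)" ls]
      by (simp add: E primitive_idempotent_def del: upt_Suc flip: ls_def)
  qed
  have x_inj: "inj_on x {..d}"
    using E_x x(1) by (intro inj_onI) (metis atMost_iff)
  have "vec.independent (x ` {..d})"
  proof (rule vec.independent_if_scalars_zero)
    fix f v
    assume sum0: "(\<Sum>v\<in>x ` {..d}. f v *s v) = 0" and "v \<in> x ` {..d}"
    then obtain i where i: "i \<le> d" "v = x i"
      by auto
    have "0 = \<rho> (E i) *v (\<Sum>j\<le>d. f (x j) *s x j)"
      using sum0 by (simp add: sum.reindex[OF x_inj])
    also have "\<dots> = (\<Sum>j\<le>d. f (x j) *s (\<rho> (E i) *v x j))"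
      by (simp add: vec.linear_sum vector_scalar_commute)
    also have "\<dots> = (\<Sum>j\<le>d. if j = i then f v *s x i else 0)"
      using i by (intro sum.cong) (auto simp: E_x)
    also have "\<dots> = f v *s x i"
      using i by simp
    finally show "f v = 0"
      using x(1)[OF i(1)] by simp
  qed simp
  then have span: "v \<in> vec.span (x ` {..d})" for v
    using vec.card_ge_dim_independent[of "x ` {..d}" UNIV] card card_image[OF x_inj]
    by (auto simp: card_cart_basis)
  have agree: "y = z" if "\<And>j. j \<le> d \<Longrightarrow> \<rho> y *v x j = \<rho> z *v x j" for y z
  proof (rule eqI)
    fix v
    show "\<rho> y *v v = \<rho> z *v v"
    proof (rule vec.span_induct[OF span[of v], where P = "\<lambda>v. \<rho> y *v v = \<rho> z *v v"])
      show "vec.subspace {v. \<rho> y *v v = \<rho> z *v v}"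
        by (auto simp: vec.subspace_def matrix_vector_right_distrib vector_scalar_commute)
    qed (use that in auto)
  qed
  have image: "\<exists>c. \<rho> (E i) *v v = c *s x i" if i: "i \<le> d" for i v
  proof (rule vec.span_induct[OF span[of v], where P = "\<lambda>v. \<exists>c. \<rho> (E i) *v v = c *s x i"])
    show "vec.subspace {v. \<exists>c. \<rho> (E i) *v v = c *s x i}"
      unfolding vec.subspace_def
      by (auto simp: matrix_vector_right_distrib vector_scalar_commute
          intro: exI[of _ 0]) (metis vec.scale_left_distrib)
    show "\<exists>c. \<rho> (E i) *v v = c *s x i" if v: "v \<in> x ` {..d}" for v
    proof -
      obtain j where "j \<le> d" "v = x j"
        using v by auto
      then have "\<rho> (E i) *v v = (if i = j then 1 else 0) *s x i"
        using i by (simp add: E_x)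
      then show ?thesis ..
    qed
  qed
  show ?thesis
  proof
    show "inj_on \<theta> {..d}"
      by (rule theta_inj)
    show "(\<Sum>i\<le>d. E i) = 1"
      by (rule agree) (simp add: sum one E_x)
    fix i
    assume i: "i \<le> d"
    show "E i * E j = (if i = j then E i else 0)" if "j \<le> d" for j
      using i that by (intro agree) (auto simp: mult E_x zero simp flip: matrix_vector_mul_assoc)
    show "E i \<noteq> 0"
      using E_x[OF i i] x(1)[OF i] zero by auto
    show "X * E i = sA (\<theta> i) (E i)"
      using i by (intro agree) (auto simp: mult E_x x scale simp flip: matrix_vector_mul_assoc)
    have "\<forall>l. \<exists>c. \<rho> (E i) *v axis l 1 = c *s x i"
      using image[OF i] by blast
    from choice[OF this] obtain a where a: "\<And>l. \<rho> (E i) *v axis l 1 = a l *s x i"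
      by blast
    have entry: "\<rho> (E i) $ k $ l = x i $ k * a l" for k l
      using arg_cong[OF a[of l], of "\<lambda>v. v $ k"]
      by (simp add: matrix_vector_mult_def axis_def mult.commute if_distrib cong: if_cong)
    \<comment> \<open>\<open>\<alpha>\<close> is the linear form of the row \<open>a\<close>; the trace of \<open>Z E\<^sub>i\<close> is its value at \<open>Z x\<^sub>i\<close>.\<close>
    define \<alpha> where "\<alpha> v = (\<Sum>l\<in>UNIV. a l * v $ l)" for v
    have E_act: "\<rho> (E i) *v v = \<alpha> v *s x i" for v
      by (simp add: vec_eq_iff matrix_vector_mult_def entry \<alpha>_def sum_distrib_left mult_ac)
    have \<alpha>_scale: "\<alpha> (c *s v) = c * \<alpha> v" for c v
      by (simp add: \<alpha>_def sum_distrib_left mult_ac)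
    show "E i * Z * E i = sA (alg_trace \<rho> (Z * E i)) (E i)" for Z
    proof (rule eqI)
      fix v
      have "alg_trace \<rho> (Z * E i) = \<alpha> (\<rho> Z *v x i)"
        by (simp add: alg_trace_def trace_def mult matrix_matrix_mult_def matrix_vector_mult_def
            entry \<alpha>_def sum_distrib_left mult_ac)
      then show "\<rho> (E i * Z * E i) *v v = \<rho> (sA (alg_trace \<rho> (Z * E i)) (E i)) *v v"
        by (simp add: mult scale E_act vector_scalar_commute \<alpha>_scale mult_ac
            flip: matrix_vector_mul_assoc)
    qed
  qed
qed

section \<open>The transition formulas\<close>

theorem theorem13p1:
  fixes d :: nat
    and sA :: "'k::field \<Rightarrow> 'a::ring_1 \<Rightarrow> 'a"
    and sV :: "'k \<Rightarrow> 'v::ab_group_add \<Rightarrow> 'v"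
    and act :: "'a \<Rightarrow> 'v \<Rightarrow> 'v"
    and \<rho> :: "'a \<Rightarrow> 'k^'n^'n"
    and A As :: 'a and E Es :: "nat \<Rightarrow> 'a"
    and \<theta> \<theta>s \<phi>1 \<phi>2 :: "nat \<Rightarrow> 'k"
    and dag :: "'a \<Rightarrow> 'a" and B :: "'v \<Rightarrow> 'v \<Rightarrow> 'k"
    and \<xi>0 \<xi>d \<xi>s0 \<xi>sd :: 'v
  assumes "CARD('n) = d + 1"
    and "matrix_algebra_iso sA \<rho>"
    and "irreducible_module sA sV act"
    and "leonard_system d sA sV act A E As Es"
    and "parameter_array d sA sV act \<rho> A E As Es \<theta> \<theta>s \<phi>1 \<phi>2"
    and "antiautomorphism sA dag" and "dag A = A" and "dag As = As"
    and "bilinear_form sV B" and "\<exists>u v. B u v \<noteq> 0"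
    and "\<And>X u v. B (act X u) v = B u (act (dag X) v)"
    and "\<xi>0 \<in> range (act (E 0))" and "\<xi>0 \<noteq> 0"
    and "\<xi>d \<in> range (act (E d))" and "\<xi>d \<noteq> 0"
    and "\<xi>s0 \<in> range (act (Es 0))" and "\<xi>s0 \<noteq> 0"
    and "\<xi>sd \<in> range (act (Es d))" and "\<xi>sd \<noteq> 0"
  shows
    "(\<forall>X \<in> attached_sequences d sA A E \<theta>. \<forall>i\<le>d.
        act (sA (B \<xi>s0 \<xi>s0 / B \<xi>d \<xi>s0)
              (\<Sum>r\<le>d. sA (1 / alg_trace \<rho> (Es r * E d)) (X r * Es 0 * E d * Es r)))
            (act (Es i) \<xi>d) = act (X i) \<xi>s0 \<and>
        act (sA (B \<xi>sd \<xi>sd / B \<xi>d \<xi>sd)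
              (\<Sum>r\<le>d. sA (1 / alg_trace \<rho> (Es r * E d)) (X r * Es d * E d * Es r)))
            (act (Es i) \<xi>d) = act (X i) \<xi>sd \<and>
        act (sA (B \<xi>s0 \<xi>s0 / B \<xi>d \<xi>s0)
              (\<Sum>r\<le>d. sA (1 / alg_trace \<rho> (Es r * E d)) (X (d - r) * Es 0 * E d * Es r)))
            (act (Es (d - i)) \<xi>d) = act (X i) \<xi>s0 \<and>
        act (sA (B \<xi>sd \<xi>sd / B \<xi>d \<xi>sd)
              (\<Sum>r\<le>d. sA (1 / alg_trace \<rho> (Es r * E d)) (X (d - r) * Es d * E d * Es r)))
            (act (Es (d - i)) \<xi>d) = act (X i) \<xi>sd)
     \<and>
     (\<forall>X \<in> attached_sequences d sA As Es \<theta>s. \<forall>i\<le>d.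
        act (sA (poly (eta_poly d \<theta> d) (\<theta> 0) / (\<Prod>j=1..d. \<phi>1 j) * (B \<xi>0 \<xi>sd / B \<xi>d \<xi>sd))
              (\<Sum>r\<le>d. sA (poly (tau_poly \<theta>s r) (\<theta>s r) * poly (eta_poly d \<theta>s (d - r)) (\<theta>s r))
                         (X r * E 0 * Es r)))
            (act (Es i) \<xi>d) = act (X i) \<xi>0 \<and>
        act (\<Sum>r\<le>d. sA (1 / alg_trace \<rho> (Es r * E d)) (X r * E d * Es r))
            (act (Es i) \<xi>d) = act (X i) \<xi>d \<and>
        act (sA (poly (eta_poly d \<theta> d) (\<theta> 0) / (\<Prod>j=1..d. \<phi>1 j) * (B \<xi>0 \<xi>sd / B \<xi>d \<xi>sd))
              (\<Sum>r\<le>d. sA (poly (tau_poly \<theta>s r) (\<theta>s r) * poly (eta_poly d \<theta>s (d - r)) (\<theta>s r))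
                         (X (d - r) * E 0 * Es r)))
            (act (Es (d - i)) \<xi>d) = act (X i) \<xi>0 \<and>
        act (\<Sum>r\<le>d. sA (1 / alg_trace \<rho> (Es r * E d)) (X (d - r) * E d * Es r))
            (act (Es (d - i)) \<xi>d) = act (X i) \<xi>d)"
proof -
  interpret irreducible_module sA sV act
    by fact
  have module: "algebra_module sA sV act"
    by unfold_locales
  have ord: "idempotent_ordering d sA sV act A E \<theta>" "idempotent_ordering d sA sV act As Es \<theta>s"
    and \<phi>1: "\<And>i. i \<in> {1..d} \<Longrightarrow> \<phi>1 i = (\<theta>s 0 - \<theta>s i) *
        (alg_trace \<rho> (alg_poly sA (tau_poly \<theta> i) A * Es 0) /
         alg_trace \<rho> (alg_poly sA (tau_poly \<theta> (i - 1)) A * Es 0))"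
    using assms(5) unfolding parameter_array_def by blast+
  note resolution = eigen_resolution_of_idempotent_ordering[OF module assms(2,1)]
  interpret R: eigen_resolution sA "alg_trace \<rho>" d A E \<theta>
    by (rule resolution[OF ord(1)])
  interpret S: eigen_resolution sA "alg_trace \<rho>" d As Es \<theta>s
    by (rule resolution[OF ord(2)])
  interpret leonard_module sA "alg_trace \<rho>" d A E \<theta> As Es \<theta>s dag sV act B
    using assms(4,6-11) by unfold_locales (auto simp: leonard_system_def)
  note dual0 = transition_to_dual[OF assms(14,15) _ le0 assms(16,17)]
  note duald = transition_to_dual[OF assms(14,15) _ order_refl assms(18,19)]
  note opposite = transition_to_opposite_end[OF assms(14,15) _ assms(12,13,18,19) \<phi>1]
  note same = transition_from_end[OF assms(14,15)]
  {
    fix X :: "nat \<Rightarrow> 'a" and i :: nat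
    assume i: "i \<le> d"
    then have i': "d - i \<le> d" and flip: "d - (d - i) = i"
      by auto
    note dual0[OF i', of "\<lambda>r. X (d - r)"] duald[OF i', of "\<lambda>r. X (d - r)"]
      opposite[OF i', of "\<lambda>r. X (d - r)"] same[OF i', of "\<lambda>r. X (d - r)"]
    note this[unfolded flip]
  }
  note flipped = this
  show ?thesis
    by (intro conjI ballI allI impI; rule dual0 duald opposite same flipped; assumption)
qed

end
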